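(* Let $\sigma>2$. There is a constant $C=C(\sigma)>0$ such that for all $L\ge 2$ and all sequences $a=\{a_K\}$, $b=\{b_K\}$, $c=\{c_K\}$ in $X^\sigma_L$, $$\left\| \mathcal{T}_L (a,b,c) \right\|_{X^\sigma_L} \le C\, \|a\|_{X^\sigma_L}\, \|b\|_{X^\sigma_L}\, \|c\|_{X^\sigma_L}.$$ Moreover, the dependence on $L$ in this estimate is sharp: there is a constant $c_0=c_0(\sigma)>0$ such that for all sufficiently large $L$ there exist nonzero sequences $a,b,c\in X^\sigma_L$ with $\|\mathcal{T}_L(a,b,c)\|_{X^\sigma_L}\ge c_0\|a\|_{X^\sigma_L}\|b\|_{X^\sigma_L}\|c\|_{X^\sigma_L}$.
   Context: For $L>0$ let $\mathbb{Z}^2_L=L^{-1}\mathbb{Z}^2$. Write $\langle x\rangle=\sqrt{1+|x|^2}$. For a complex sequence $a=\{a_K\}_{K\in\mathbb{Z}^2_L}$, $\|a\|_{X^\sigma_L}=\sup_{K\in\mathbb{Z}^2_L}\langle K\rangle^\sigma|a_K|$, and $X^\sigma_L$ is the space of sequences for which this is finite. For $K\in\mathbb{Z}^2_L$ let $$\mathcal{R}(K)=\{(K_1,K_2,K_3)\in(\mathbb{Z}^2_L)^3:\ K_1-K_2+K_3=K,\ |K_1|^2-|K_2|^2+|K_3|^2-|K|^2=0\}.$$ For $L>1$ the normalized trilinear operator is $$\mathcal{T}_L(e,f,g)(K)=\frac{\zeta(2)}{2L^2\log L}\sum_{(K_1,K_2,K_3)\in\mathcal{R}(K)}e_{K_1}f_{K_2}g_{K_3},\qquad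 \zeta(2)=\frac{\pi^2}{6}.$$ *)

theory Defs
  imports "HOL-Analysis.Analysis"
begin

definition lattice2 :: "real \<Rightarrow> (real^2) set" where
  "lattice2 L = (\<lambda>n. n /\<^sub>R L) ` {n. \<forall>i. n $ i \<in> \<int>}"

definition japanese :: "real^2 \<Rightarrow> real" where
  "japanese x = sqrt (1 + (norm x)\<^sup>2)"

text \<open>
  A sequence indexed by \<open>lattice2 L\<close> is represented by a function on the whole plane.
  Every notion below only inspects its values on \<open>lattice2 L\<close>.
\<close>

type_synonym lseq = "real^2 \<Rightarrow> complex"

definition X_space :: "real \<Rightarrow> real \<Rightarrow> lseq set" where
  "X_space \<sigma> L =
     {a. bdd_above ((\<lambda>K. japanese K powr \<sigma> * norm (a K)) ` lattice2 L)}"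

text \<open>The supremum is taken in the reals, so it is only meaningful on \<open>X_space \<sigma> L\<close>.\<close>

definition X_norm :: "real \<Rightarrow> real \<Rightarrow> lseq \<Rightarrow> real" where
  "X_norm \<sigma> L a = (SUP K\<in>lattice2 L. japanese K powr \<sigma> * norm (a K))"

definition resonant :: "real \<Rightarrow> real^2 \<Rightarrow> ((real^2) \<times> (real^2) \<times> (real^2)) set" where
  "resonant L K =
     {(K1, K2, K3). K1 \<in> lattice2 L \<and> K2 \<in> lattice2 L \<and> K3 \<in> lattice2 L \<and>
        K1 - K2 + K3 = K \<and>
        (norm K1)\<^sup>2 - (norm K2)\<^sup>2 + (norm K3)\<^sup>2 - (norm K)\<^sup>2 = 0}"

definition zeta2 :: real where
  "zeta2 = pi\<^sup>2 / 6"

text \<open>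
  The resonant set is infinite, and \<open>infsum\<close> is \<open>0\<close> on families that are not summable;
  statements about \<open>T_op\<close> should therefore come with summability of the family.
\<close>

definition T_op :: "real \<Rightarrow> lseq \<Rightarrow> lseq \<Rightarrow> lseq \<Rightarrow> lseq" where
  "T_op L e f g K =
     complex_of_real (zeta2 / (2 * L\<^sup>2 * ln L)) *
       (\<Sum>\<^sub>\<infinity>(K1, K2, K3)\<in>resonant L K. e K1 * f K2 * g K3)"

end

theory Submission
  imports Defs
begin

text \<open>
  Put \<open>u = K1 - K\<close> and \<open>v = K3 - K\<close>. The resonant triples are the rectangles
  \<open>(K + u, K + u + v, K + v)\<close> with \<open>u\<close> orthogonal to \<open>v\<close>. Since
  \<open>norm K\<^sup>2 \<le> norm K1\<^sup>2 + norm K3\<^sup>2\<close>, the weight at \<open>K1\<close> or at \<open>K3\<close> pays for the one at \<open>K\<close>, and by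
  symmetry the upper bound becomes the estimate of the sum of
  \<open>\<langle>K + u\<rangle>\<^sup>-\<^sup>\<sigma> \<langle>K + u + v\<rangle>\<^sup>-\<^sup>\<sigma>\<close> over orthogonal \<open>u\<close>, \<open>v\<close> by a multiple of \<open>L\<^sup>2 ln L\<close>, uniformly
  in \<open>K\<close>.

  For \<open>u \<noteq> 0\<close> write \<open>u = k p / L\<close> with a primitive integer vector \<open>p\<close>. Then \<open>v\<close> runs through the multiples of the
  rotated vector \<open>p / L\<close>, and a sum of \<open>\<langle>x\<rangle>\<^sup>-\<^sup>\<sigma>\<close> along a line with spacing \<open>d\<close> is at most a multiple
  of \<open>1 + 1 / d\<close> (\<open>line_decay_sum_bound\<close>), here \<open>1 + L / norm p\<close>. For \<open>norm p > L\<close> this is bounded and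
  the remaining sum over \<open>u\<close> is at most a multiple of \<open>L\<^sup>2\<close> because \<open>\<sigma> > 2\<close>
  (\<open>plane_decay_sum_bound\<close>). For \<open>norm p \<le> L\<close> the sum over \<open>k\<close> runs along a line with the same
  spacing, so that the total is at most a multiple of the sum of \<open>(L / norm p)\<^sup>2\<close> over nonzero integer
  vectors of size at most \<open>L\<close>, which is of order \<open>L\<^sup>2 ln L\<close>. All of this is carried out for finite
  families; the bounds are uniform, hence the resonant sums converge absolutely.

  For sharpness let all three sequences be the indicator of the unit box, whose norm is bounded in
  \<open>L\<close>, and look at \<open>K = 0\<close>. The pairs \<open>u = k p / L\<close> and \<open>v = m (rot p) / L\<close> with coprime \<open>p\<close> and
  \<open>k, m > 0\<close> are distinct, and a \<open>p\<close> of size at most \<open>L / 2\<close> contributes of order \<open>(L / norm p)\<^sup>2\<close> of them to the box. Restricting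
  the sum of \<open>1 / norm p\<^sup>2\<close> to coprime vectors costs at most the factor \<open>\<zeta>(2)\<close>
  (\<open>coprime_triangle_sum_ge\<close>), so the logarithm survives.
\<close>

section \<open>Decay sums along lines and over the plane\<close>

lemma japanese_ge_1: "1 \<le> japanese x"
  by (simp add: japanese_def)

lemma japanese_powr_antimono:
  assumes "0 \<le> s" "1 \<le> r" "r \<le> japanese x"
  shows "japanese x powr -s \<le> r powr -s"
  using assms by (intro powr_mono2') auto

lemma int_decay_sum_bound:
  assumes "s > 1"
  shows "\<exists>C>0. \<forall>J. finite J \<longrightarrow> (\<Sum>j\<in>J. (1 + \<bar>real_of_int j\<bar>) powr -s) \<le> C"
proof -
  define f where "f n = real (Suc n) powr -s" for n
  have f: "summable f" "\<And>n. f n \<ge> 0"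
    using assms summable_real_powr_iff[of "-s"]
    unfolding f_def by (subst summable_Suc_iff, auto)
  have *: "(\<Sum>j\<in>J. (1 + \<bar>real_of_int j\<bar>) powr -s) \<le> suminf f"
    if "finite J" "inj_on (\<lambda>j. nat \<bar>j\<bar>) J" for J
  proof -
    have "(\<Sum>j\<in>J. (1 + \<bar>real_of_int j\<bar>) powr -s) = (\<Sum>n\<in>(\<lambda>j. nat \<bar>j\<bar>) ` J. f n)"
      by (subst sum.reindex[OF that(2)]) (simp add: f_def add.commute)
    also have "\<dots> \<le> suminf f"
      using f that by (intro sum_le_suminf) auto
    finally show ?thesis .
  qed
  have "(\<Sum>j\<in>J. (1 + \<bar>real_of_int j\<bar>) powr -s) \<le> 2 * suminf f + 1" if "finite J" for J
  proof -
    have "(\<Sum>j\<in>J. (1 + \<bar>real_of_int j\<bar>) powr -s)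
        = (\<Sum>j\<in>{j\<in>J. j \<ge> 0}. (1 + \<bar>real_of_int j\<bar>) powr -s)
          + (\<Sum>j\<in>{j\<in>J. j < 0}. (1 + \<bar>real_of_int j\<bar>) powr -s)"
      using that by (subst sum.union_disjoint[symmetric]) (auto intro!: sum.cong)
    also have "\<dots> \<le> suminf f + suminf f"
      using that by (intro add_mono *) (auto simp: inj_on_def)
    finally show ?thesis by simp
  qed
  moreover have "2 * suminf f + 1 > 0"
    using suminf_nonneg[OF f] by simp
  ultimately show ?thesis by blast
qed

text \<open>An interval of length \<open>1\<close> contains at most \<open>1 + 1/d\<close> terms of an arithmetic progression
  with step \<open>d\<close>, so grouping the progression by integer parts compares it with the sum over the
  integers.\<close>

lemma progression_decay_sum_bound:
  assumes "s > 1"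
  shows "\<exists>C>0. \<forall>y d S. d > 0 \<longrightarrow> finite S \<longrightarrow>
           (\<Sum>m\<in>S. sqrt (1 + (y + real_of_int m * d)\<^sup>2) powr -s) \<le> C * (1 + 1 / d)"
proof -
  obtain C where C: "C > 0"
      "\<And>J. finite J \<Longrightarrow> (\<Sum>j\<in>J. (1 + \<bar>real_of_int j\<bar>) powr -s) \<le> C"
    using int_decay_sum_bound[OF assms] by blast
  have "(\<Sum>m\<in>S. sqrt (1 + (y + real_of_int m * d)\<^sup>2) powr -s) \<le> (3 powr s * C) * (1 + 1 / d)"
    if d: "d > 0" and S: "finite S" for y d S
  proof -
    define fl where "fl m = \<lfloor>y + real_of_int m * d\<rfloor>" for m
    have le: "sqrt (1 + (y + real_of_int m * d)\<^sup>2) powr -s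
        \<le> 3 powr s * (1 + \<bar>real_of_int (fl m)\<bar>) powr -s" for m
    proof -
      define t where "t = y + real_of_int m * d"
      define q where "q = sqrt (1 + t\<^sup>2)"
      have "\<bar>t\<bar> \<le> q" "1 \<le> q"
        unfolding q_def by (auto simp: real_le_rsqrt)
      moreover have "\<bar>real_of_int (fl m)\<bar> \<le> 1 + \<bar>t\<bar>"
        unfolding fl_def t_def by linarith
      ultimately have "1 + \<bar>real_of_int (fl m)\<bar> \<le> 3 * q"
        by argo
      then have "(1 + \<bar>real_of_int (fl m)\<bar>) / 3 \<le> sqrt (1 + t\<^sup>2)"
        by (simp add: q_def)
      then have "sqrt (1 + t\<^sup>2) powr -s \<le> ((1 + \<bar>real_of_int (fl m)\<bar>) / 3) powr -s"
        using assms by (intro powr_mono2') auto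
      also have "\<dots> = 3 powr s * (1 + \<bar>real_of_int (fl m)\<bar>) powr -s"
        by (simp add: powr_divide powr_minus field_simps)
      finally show ?thesis by (simp add: t_def)
    qed
    have cnt: "real (card {m\<in>S. fl m = j}) \<le> 1 + 1 / d" for j
    proof -
      have sub: "{m\<in>S. fl m = j} \<subseteq> {\<lceil>(j - y) / d\<rceil> ..< \<lceil>(j + 1 - y) / d\<rceil>}"
      proof
        fix m assume "m \<in> {m\<in>S. fl m = j}"
        then have "real_of_int j \<le> y + m * d" "y + m * d < real_of_int j + 1"
          unfolding fl_def by auto
        then have "(j - y) / d \<le> m" "m < (j + 1 - y) / d"
          using d by (simp_all add: field_simps)
        then show "m \<in> {\<lceil>(j - y) / d\<rceil> ..< \<lceil>(j + 1 - y) / d\<rceil>}"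
          by (simp add: ceiling_le_iff less_ceiling_iff)
      qed
      have "card {m\<in>S. fl m = j} \<le> nat (\<lceil>(j + 1 - y) / d\<rceil> - \<lceil>(j - y) / d\<rceil>)"
        using card_mono[OF _ sub] by simp
      moreover have "(j + 1 - y) / d = (j - y) / d + 1 / d"
        by (simp add: add_divide_distrib diff_divide_distrib)
      moreover have "1 / d > 0" using d by simp
      ultimately show ?thesis by linarith
    qed
    have "(\<Sum>m\<in>S. sqrt (1 + (y + real_of_int m * d)\<^sup>2) powr -s)
        \<le> (\<Sum>m\<in>S. 3 powr s * (1 + \<bar>real_of_int (fl m)\<bar>) powr -s)"
      by (intro sum_mono le)
    also have "\<dots> = (\<Sum>j\<in>fl ` S. real (card {m\<in>S. fl m = j}) * (3 powr s * (1 + \<bar>real_of_int j\<bar>) powr -s))"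
      using S by (intro sum_fun_comp) auto
    also have "\<dots> \<le> (\<Sum>j\<in>fl ` S. (1 + 1 / d) * (3 powr s * (1 + \<bar>real_of_int j\<bar>) powr -s))"
      by (intro sum_mono mult_right_mono cnt) simp
    also have "\<dots> = (1 + 1 / d) * (3 powr s * (\<Sum>j\<in>fl ` S. (1 + \<bar>real_of_int j\<bar>) powr -s))"
      by (simp add: sum_distrib_left)
    also have "\<dots> \<le> (1 + 1 / d) * (3 powr s * C)"
      using S C d by (intro mult_left_mono) auto
    finally show ?thesis by (simp add: mult_ac)
  qed
  moreover have "3 powr s * C > 0" using C by simp
  ultimately show ?thesis by blast
qed

text \<open>The projection to the direction of the line does not increase norms, which reduces the
  plane to one dimension.\<close>

lemma line_decay_sum_bound:
  assumes "s > 1"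
  shows "\<exists>C>0. \<forall>x w S. w \<noteq> 0 \<longrightarrow> finite S \<longrightarrow>
           (\<Sum>m\<in>S. japanese (x + real_of_int m *\<^sub>R w) powr -s) \<le> C * (1 + 1 / norm w)"
proof -
  obtain C where C: "C > 0" "\<And>y d S. d > 0 \<Longrightarrow> finite S \<Longrightarrow>
      (\<Sum>m\<in>S. sqrt (1 + (y + real_of_int m * d)\<^sup>2) powr -s) \<le> C * (1 + 1 / d)"
    using progression_decay_sum_bound[OF assms] by metis
  have "(\<Sum>m\<in>S. japanese (x + real_of_int m *\<^sub>R w) powr -s) \<le> C * (1 + 1 / norm w)"
    if w: "w \<noteq> 0" and S: "finite S" for x w S
  proof -
    have "japanese (x + real_of_int m *\<^sub>R w) powr -s
        \<le> sqrt (1 + (x \<bullet> w / norm w + real_of_int m * norm w)\<^sup>2) powr -s" for m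
    proof (rule japanese_powr_antimono)
      let ?z = "x + real_of_int m *\<^sub>R w"
      have "x \<bullet> w / norm w + real_of_int m * norm w = (?z \<bullet> w) / norm w"
        using w by (simp add: inner_add_left field_simps power2_norm_eq_inner[symmetric] power2_eq_square)
      moreover have "\<bar>(?z \<bullet> w) / norm w\<bar> \<le> norm ?z"
        using w Cauchy_Schwarz_ineq2[of ?z w] by (simp add: field_simps)
      ultimately have "(x \<bullet> w / norm w + real_of_int m * norm w)\<^sup>2 \<le> (norm ?z)\<^sup>2"
        by (metis abs_le_square_iff abs_norm_cancel)
      then show "sqrt (1 + (x \<bullet> w / norm w + real_of_int m * norm w)\<^sup>2) \<le> japanese ?z"
        by (simp add: japanese_def)
    qed (use assms in auto)
    then have "(\<Sum>m\<in>S. japanese (x + real_of_int m *\<^sub>R w) powr -s)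
        \<le> (\<Sum>m\<in>S. sqrt (1 + (x \<bullet> w / norm w + real_of_int m * norm w)\<^sup>2) powr -s)"
      by (intro sum_mono)
    also have "\<dots> \<le> C * (1 + 1 / norm w)"
      using w S by (intro C) auto
    finally show ?thesis .
  qed
  with C(1) show ?thesis by blast
qed

text \<open>Integer coordinates on \<open>lattice2 L\<close>, which make divisibility arguments available.\<close>

definition pt :: "real \<Rightarrow> int \<times> int \<Rightarrow> real^2" where
  "pt L p = vector [of_int (fst p) / L, of_int (snd p) / L]"

lemma pt_component [simp]: "pt L p $ 1 = of_int (fst p) / L" "pt L p $ 2 = of_int (snd p) / L"
  by (simp_all add: pt_def)

lemma lattice2_eq: "lattice2 L = range (pt L)"
proof (intro equalityI subsetI)
  fix x assume "x \<in> lattice2 L"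
  then obtain n where n: "x = n /\<^sub>R L" "\<forall>i. n $ i \<in> \<int>" by (auto simp: lattice2_def)
  then obtain a b where "n $ 1 = of_int a" "n $ 2 = of_int b" by (metis Ints_cases)
  then have "x = pt L (a, b)" by (simp add: n vec_eq_iff forall_2 divide_inverse mult.commute)
  then show "x \<in> range (pt L)" by blast
next
  fix x assume "x \<in> range (pt L)"
  then obtain p where "x = pt L p" by auto
  then have "x = pt 1 p /\<^sub>R L" by (simp add: vec_eq_iff forall_2 divide_inverse mult.commute)
  then show "x \<in> lattice2 L" by (auto simp: lattice2_def forall_2 intro!: image_eqI[of _ _ "pt 1 p"])
qed

lemma norm_sq_2: "(norm (x::real^2))\<^sup>2 = (x $ 1)\<^sup>2 + (x $ 2)\<^sup>2"
  by (simp add: norm_vec_def L2_set_def sum_2)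

text \<open>Each component of \<open>x\<close> is at most \<open>norm x\<close>, so half of the exponent \<open>\<sigma> > 2\<close> can be spent on
  each of the two coordinates, and one dimension suffices.\<close>

lemma plane_decay_sum_bound:
  assumes "\<sigma> > 2"
  shows "\<exists>C>0. \<forall>L x S. 1 \<le> L \<longrightarrow> finite S \<longrightarrow>
           (\<Sum>p\<in>S. japanese (x + pt L p) powr -\<sigma>) \<le> C * L\<^sup>2"
proof -
  define s where "s = \<sigma> / 2"
  have s: "s > 1" using assms by (simp add: s_def)
  obtain C where C: "C > 0" "\<And>y d S. d > 0 \<Longrightarrow> finite S \<Longrightarrow>
      (\<Sum>m\<in>S. sqrt (1 + (y + real_of_int m * d)\<^sup>2) powr -s) \<le> C * (1 + 1 / d)"
    using progression_decay_sum_bound[OF s] by metis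
  have "(\<Sum>p\<in>S. japanese (x + pt L p) powr -\<sigma>) \<le> (2 * C)\<^sup>2 * L\<^sup>2"
    if L: "1 \<le> L" and S: "finite S" for L x S
  proof -
    define f where "f i m = sqrt (1 + (x $ i + real_of_int m * (1 / L))\<^sup>2) powr -s" for i :: 2 and m
    have f: "f i m \<ge> 0" for i m by (simp add: f_def)
    have line: "(\<Sum>m\<in>A. f i m) \<le> 2 * C * L" if "finite A" for A i
    proof -
      have "(\<Sum>m\<in>A. f i m) \<le> C * (1 + 1 / (1 / L))"
        unfolding f_def using L that by (intro C) auto
      also have "\<dots> \<le> C * (2 * L)" using L C by (intro mult_left_mono) auto
      finally show ?thesis by (simp add: mult_ac)
    qed
    have le: "japanese (x + pt L p) powr -\<sigma> \<le> f 1 (fst p) * f 2 (snd p)" for p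
    proof -
      have "japanese (x + pt L p) powr -\<sigma> = japanese (x + pt L p) powr -s * japanese (x + pt L p) powr -s"
        by (simp add: s_def powr_add[symmetric])
      also have "\<dots> \<le> f 1 (fst p) * f 2 (snd p)"
        unfolding f_def using s
        by (intro mult_mono japanese_powr_antimono) (auto simp: japanese_def norm_sq_2)
      finally show ?thesis .
    qed
    have "(\<Sum>p\<in>S. japanese (x + pt L p) powr -\<sigma>) \<le> (\<Sum>p\<in>S. f 1 (fst p) * f 2 (snd p))"
      by (intro sum_mono le)
    also have "\<dots> \<le> (\<Sum>p\<in>fst ` S \<times> snd ` S. f 1 (fst p) * f 2 (snd p))"
      using S f by (intro sum_mono2) (auto intro: rev_image_eqI)
    also have "\<dots> = (\<Sum>m\<in>fst ` S. f 1 m) * (\<Sum>n\<in>snd ` S. f 2 n)"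
      by (simp add: sum_product sum.cartesian_product case_prod_unfold)
    also have "\<dots> \<le> (2 * C * L) * (2 * C * L)"
      using S L C f by (intro mult_mono line sum_nonneg) auto
    finally show ?thesis by (simp add: power2_eq_square mult_ac)
  qed
  moreover have "(2 * C)\<^sup>2 > 0" using C by simp
  ultimately show ?thesis by blast
qed

section \<open>Lattice vectors and primitive directions\<close>

definition sup_size :: "int \<times> int \<Rightarrow> nat" where
  "sup_size p = nat (max \<bar>fst p\<bar> \<bar>snd p\<bar>)"

definition content :: "int \<times> int \<Rightarrow> int" where
  "content N = gcd (fst N) (snd N)"

definition primitive_part :: "int \<times> int \<Rightarrow> int \<times> int" where
  "primitive_part N = (fst N div content N, snd N div content N)"

definition int_scale :: "int \<Rightarrow> int \<times> int \<Rightarrow> int \<times> int" where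
  "int_scale k p = (k * fst p, k * snd p)"

definition rot :: "int \<times> int \<Rightarrow> int \<times> int" where
  "rot p = (- snd p, fst p)"

definition orthogonal_pairs :: "((int \<times> int) \<times> (int \<times> int)) set" where
  "orthogonal_pairs = {(N, M). fst N * fst M + snd N * snd M = 0}"

lemma pt_int_scale: "pt L (int_scale k p) = of_int k *\<^sub>R pt L p"
  by (simp add: vec_eq_iff forall_2 int_scale_def)

lemma pt_eq_0_iff: "L \<noteq> 0 \<Longrightarrow> pt L p = 0 \<longleftrightarrow> p = (0, 0)"
  by (cases p) (simp add: vec_eq_iff forall_2)

lemma int_scale_primitive_part: "int_scale (content N) (primitive_part N) = N"
  by (simp add: int_scale_def primitive_part_def content_def)

lemma primitive_part_nonzero: "N \<noteq> (0, 0) \<Longrightarrow> primitive_part N \<noteq> (0, 0)"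
  using int_scale_primitive_part[of N] by (auto simp: int_scale_def)

lemma coprime_primitive_part:
  "N \<noteq> (0, 0) \<Longrightarrow> coprime (fst (primitive_part N)) (snd (primitive_part N))"
  by (cases N) (auto simp: primitive_part_def content_def div_gcd_coprime)

lemma sup_size_rot [simp]: "sup_size (rot p) = sup_size p"
  by (simp add: sup_size_def rot_def max.commute)

lemma sup_size_pos: "p \<noteq> (0, 0) \<Longrightarrow> sup_size p > 0"
  by (cases p) (auto simp: sup_size_def)

lemma sup_size_le_norm_pt:
  assumes "L > 0"
  shows "sup_size p / L \<le> norm (pt L p)"
proof -
  have "\<bar>of_int (fst p)\<bar> / L \<le> norm (pt L p)" "\<bar>of_int (snd p)\<bar> / L \<le> norm (pt L p)"
    using component_le_norm_cart[of "pt L p" 1] component_le_norm_cart[of "pt L p" 2] assms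
    by simp_all
  then show ?thesis
    by (auto simp: sup_size_def max_def)
qed

text \<open>If \<open>a x + b y = 0\<close> with \<open>a, b\<close> coprime, then \<open>a\<close> divides \<open>y\<close>, and the quotient is the
  multiplier.\<close>

lemma orthogonal_multiple_of_rot:
  assumes "(N, M) \<in> orthogonal_pairs" "N \<noteq> (0, 0)"
  obtains m where "M = int_scale m (rot (primitive_part N))"
proof -
  obtain a b where p: "primitive_part N = (a, b)" by (cases "primitive_part N")
  obtain x y where M: "M = (x, y)" by (cases M)
  have N: "N = (content N * a, content N * b)"
    using int_scale_primitive_part[of N] p by (simp add: int_scale_def)
  have "content N \<noteq> 0" using assms(2) N by auto
  moreover have "fst N * x + snd N * y = 0"
    using assms(1) M by (simp add: orthogonal_pairs_def)
  then have "content N * (a * x + b * y) = 0"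
    by (subst (asm) (1 2) N) (simp add: algebra_simps)
  ultimately have ax: "a * x = - (b * y)" by simp
  have cop: "coprime a b" using coprime_primitive_part[OF assms(2)] p by simp
  have "a dvd b * y" using ax by (metis dvd_minus_iff dvd_triv_left)
  then have "a dvd y" using cop by (simp add: coprime_dvd_mult_right_iff)
  then obtain m where y: "y = a * m" by blast
  have "a * (x + b * m) = 0" using ax y by (simp add: algebra_simps)
  show ?thesis
  proof (cases "a = 0")
    case False
    then have "x = - (b * m)" using \<open>a * (x + b * m) = 0\<close> by simp
    then show ?thesis using y by (intro that[of m]) (simp add: p M int_scale_def rot_def mult.commute)
  next
    case True
    then have "b = 1 \<or> b = -1" using cop by auto
    then show ?thesis using True y
      by (intro that[of "- b * x"]) (auto simp: p M int_scale_def rot_def)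
  qed
qed

section \<open>The logarithmic sum over directions\<close>

lemma harm_le_ln: "n \<ge> 1 \<Longrightarrow> harm n \<le> 1 + ln (real n)"
  using decseqD[OF decseq_harm_diff_ln, of 0 "n - 1"] by (simp add: harm_def)

text \<open>The sphere of radius \<open>n\<close> in the sup norm has at most \<open>12 n\<close> points, which turns a sum of \<open>1 / n\<^sup>2\<close>
  over nonzero vectors into a harmonic one.\<close>

lemma card_sphere_le:
  assumes "n > 0"
  shows "card {p\<in>P. sup_size p = n} \<le> 12 * n"
proof -
  let ?I = "{- int n..int n}" and ?E = "{int n, - int n}"
  have "{p\<in>P. sup_size p = n} \<subseteq> ?E \<times> ?I \<union> ?I \<times> ?E"
  proof
    fix p assume "p \<in> {p\<in>P. sup_size p = n}"
    then have "max \<bar>fst p\<bar> \<bar>snd p\<bar> = int n" by (auto simp: sup_size_def)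
    then show "p \<in> ?E \<times> ?I \<union> ?I \<times> ?E" by (cases p) (auto simp: max_def split: if_splits)
  qed
  then have "card {p\<in>P. sup_size p = n} \<le> card (?E \<times> ?I \<union> ?I \<times> ?E)"
    by (intro card_mono) auto
  also have "\<dots> \<le> card (?E \<times> ?I) + card (?I \<times> ?E)" by (rule card_Un_le)
  also have "\<dots> = 4 * (2 * n + 1)"
    using assms by (simp add: card_cartesian_product nat_add_distrib)
  also have "\<dots> \<le> 12 * n" using assms by simp
  finally show ?thesis .
qed

lemma sum_inverse_square_size_le:
  fixes L :: real
  assumes "finite P" "(0, 0) \<notin> P" "\<And>p. p \<in> P \<Longrightarrow> sup_size p \<le> L" "L \<ge> 1"
  shows "(\<Sum>p\<in>P. 1 / real (sup_size p) ^ 2) \<le> 12 * (1 + ln L)"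
proof -
  define n where "n = nat \<lfloor>L\<rfloor>"
  have n: "n \<ge> 1" "real n \<le> L" using assms(4) by (simp_all add: n_def le_nat_iff)
  have "sup_size ` P \<subseteq> {1..n}"
  proof
    fix k assume "k \<in> sup_size ` P"
    then obtain p where p: "p \<in> P" "k = sup_size p" by auto
    then have "k > 0" using assms(2) sup_size_pos[of p] by (cases "p = (0,0)") auto
    moreover have "k \<le> n" using assms(3)[OF p(1)] p(2) by (simp add: n_def le_nat_iff le_floor_iff)
    ultimately show "k \<in> {1..n}" by simp
  qed
  then have "(\<Sum>p\<in>P. 1 / real (sup_size p) ^ 2)
      = (\<Sum>k=1..n. real (card {p\<in>P. sup_size p = k}) * (1 / real k ^ 2))"
    using assms(1) by (intro sum_fun_comp) auto
  also have "\<dots> \<le> (\<Sum>k=1..n. 12 * inverse (real k))"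
  proof (intro sum_mono)
    fix k assume "k \<in> {1..n}"
    then have k: "k > 0" by simp
    have "real (card {p\<in>P. sup_size p = k}) \<le> 12 * real k"
      using card_sphere_le[OF k, of P] by linarith
    then have "real (card {p\<in>P. sup_size p = k}) * (1 / real k ^ 2) \<le> (12 * real k) * (1 / real k ^ 2)"
      by (intro mult_right_mono) auto
    also have "\<dots> = 12 * inverse (real k)" using k by (simp add: power2_eq_square field_simps)
    finally show "real (card {p\<in>P. sup_size p = k}) * (1 / real k ^ 2) \<le> 12 * inverse (real k)" .
  qed
  also have "\<dots> = 12 * harm n" by (simp add: harm_def sum_distrib_left)
  also have "\<dots> \<le> 12 * (1 + ln L)"
  proof -
    have "ln (real n) \<le> ln L" using n by (intro ln_mono) auto
    then show ?thesis using harm_le_ln[OF n(1)] by simp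
  qed
  finally show ?thesis .
qed

section \<open>Sums over orthogonal pairs\<close>

lemma japanese_powr_le_1: "0 \<le> s \<Longrightarrow> japanese x powr -s \<le> 1"
  using japanese_powr_antimono[of s 1 x] japanese_ge_1 by simp

lemma multiples_sum_bound:
  assumes "s > 1"
  shows "\<exists>C>0. \<forall>L x p A. L \<ge> 1 \<longrightarrow> p \<noteq> (0, 0) \<longrightarrow> finite A \<longrightarrow> A \<subseteq> range (\<lambda>k. int_scale k p) \<longrightarrow>
           (\<Sum>N\<in>A. japanese (x + pt L N) powr -s) \<le> C * (1 + L / sup_size p)"
proof -
  obtain C where C: "C > 0" "\<And>x w S. w \<noteq> 0 \<Longrightarrow> finite S \<Longrightarrow>
      (\<Sum>m\<in>S. japanese (x + real_of_int m *\<^sub>R w) powr -s) \<le> C * (1 + 1 / norm w)"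
    using line_decay_sum_bound[OF assms] by metis
  have "(\<Sum>N\<in>A. japanese (x + pt L N) powr -s) \<le> C * (1 + L / sup_size p)"
    if L: "L \<ge> 1" and p: "p \<noteq> (0, 0)" and A: "finite A" "A \<subseteq> range (\<lambda>k. int_scale k p)" for L x p A
  proof -
    obtain S where S: "finite S" "A = (\<lambda>k. int_scale k p) ` S"
      using finite_subset_image[OF A] by blast
    have "(\<Sum>N\<in>A. japanese (x + pt L N) powr -s)
        \<le> (\<Sum>k\<in>S. japanese (x + pt L (int_scale k p)) powr -s)"
      using sum_image_le[OF S(1), of "\<lambda>N. japanese (x + pt L N) powr -s" "\<lambda>k. int_scale k p"]
      by (simp add: S(2) o_def)
    also have "\<dots> \<le> C * (1 + 1 / norm (pt L p))"
      unfolding pt_int_scale using L p S by (intro C) (simp_all add: pt_eq_0_iff)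
    also have "\<dots> \<le> C * (1 + L / sup_size p)"
    proof -
      have "0 < sup_size p / L" using L sup_size_pos[OF p] by simp
      then have "1 / norm (pt L p) \<le> 1 / (sup_size p / L)"
        using L sup_size_le_norm_pt[of L p] by (intro divide_left_mono mult_pos_pos) linarith+
      then show ?thesis using C by simp
    qed
    finally show ?thesis .
  qed
  with C(1) show ?thesis by blast
qed

text \<open>A vector orthogonal to \<open>N \<noteq> 0\<close> is a multiple of the rotated primitive part \<open>p\<close> of \<open>N\<close>,
  so the sum runs along a line with spacing \<open>norm p / L\<close>.\<close>

lemma orthogonal_line_sum_bound:
  assumes "s > 1"
  shows "\<exists>C>0. \<forall>L x N A. L \<ge> 1 \<longrightarrow> N \<noteq> (0, 0) \<longrightarrow> finite A \<longrightarrow> A \<subseteq> orthogonal_pairs `` {N} \<longrightarrow>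
           (\<Sum>M\<in>A. japanese (x + pt L M) powr -s) \<le> C * (1 + L / sup_size (primitive_part N))"
proof -
  obtain C where C: "C > 0" "\<And>L x p A. L \<ge> 1 \<Longrightarrow> p \<noteq> (0, 0) \<Longrightarrow> finite A \<Longrightarrow>
      A \<subseteq> range (\<lambda>k. int_scale k p) \<Longrightarrow>
      (\<Sum>N\<in>A. japanese (x + pt L N) powr -s) \<le> C * (1 + L / sup_size p)"
    using multiples_sum_bound[OF assms] by blast
  have "(\<Sum>M\<in>A. japanese (x + pt L M) powr -s) \<le> C * (1 + L / sup_size (primitive_part N))"
    if L: "L \<ge> 1" and N: "N \<noteq> (0, 0)" and A: "finite A" "A \<subseteq> orthogonal_pairs `` {N}" for L x N A
  proof -
    have "A \<subseteq> range (\<lambda>k. int_scale k (rot (primitive_part N)))"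
    proof
      fix M assume "M \<in> A"
      then have "(N, M) \<in> orthogonal_pairs" using A by auto
      then show "M \<in> range (\<lambda>k. int_scale k (rot (primitive_part N)))"
        using N by (metis orthogonal_multiple_of_rot rangeI)
    qed
    moreover have "rot (primitive_part N) \<noteq> (0, 0)"
      using primitive_part_nonzero[OF N] by (cases "primitive_part N") (auto simp: rot_def)
    ultimately show ?thesis using C(2)[OF L _ A(1), of "rot (primitive_part N)" x] by simp
  qed
  with C(1) show ?thesis by blast
qed

text \<open>Group the vectors \<open>N\<close> by their primitive part \<open>p\<close>. Write \<open>\<bar>p\<bar>\<close> for its sup norm. If \<open>\<bar>p\<bar> > L\<close>, the factor is
  at most \<open>2\<close> and the plane sum suffices. Otherwise the \<open>N\<close> with primitive part \<open>p\<close> lie on one line,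
  which produces a second factor \<open>L / \<bar>p\<bar>\<close>; the sum of \<open>(L / \<bar>p\<bar>)\<^sup>2\<close> over \<open>\<bar>p\<bar> \<le> L\<close> is where
  the logarithm comes from.\<close>

lemma primitive_direction_sum_bound:
  assumes "\<sigma> > 2"
  shows "\<exists>C>0. \<forall>L x A. L \<ge> 1 \<longrightarrow> finite A \<longrightarrow> (0, 0) \<notin> A \<longrightarrow>
           (\<Sum>N\<in>A. japanese (x + pt L N) powr -\<sigma> * (1 + L / sup_size (primitive_part N)))
             \<le> C * (L\<^sup>2 * (1 + ln L))"
proof -
  let ?j = "\<lambda>x. japanese x powr -\<sigma>"
  obtain C1 where C1: "C1 > 0" "\<And>L x S. 1 \<le> L \<Longrightarrow> finite S \<Longrightarrow> (\<Sum>p\<in>S. ?j (x + pt L p)) \<le> C1 * L\<^sup>2"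
    using plane_decay_sum_bound[OF assms] by metis
  have "\<sigma> > 1" using assms by simp
  then obtain C2 where C2: "C2 > 0" "\<And>L x p A. L \<ge> 1 \<Longrightarrow> p \<noteq> (0, 0) \<Longrightarrow> finite A \<Longrightarrow>
      A \<subseteq> range (\<lambda>k. int_scale k p) \<Longrightarrow> (\<Sum>N\<in>A. ?j (x + pt L N)) \<le> C2 * (1 + L / sup_size p)"
    using multiples_sum_bound[of \<sigma>] by blast
  have "(\<Sum>N\<in>A. ?j (x + pt L N) * (1 + L / sup_size (primitive_part N)))
      \<le> (2 * C1 + 48 * C2) * (L\<^sup>2 * (1 + ln L))"
    if L: "L \<ge> 1" and A: "finite A" "(0, 0) \<notin> A" for L x A
  proof -
    let ?r = "\<lambda>p. L / real (sup_size p)"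
    define B where "B = {N\<in>A. real (sup_size (primitive_part N)) \<le> L}"
    define P where "P = primitive_part ` B"
    have fin: "finite B" "finite P" using A by (auto simp: B_def P_def)
    have P0: "(0, 0) \<notin> P" 
    proof
      assume "(0, 0) \<in> P"
      then obtain N where "N \<in> A" "primitive_part N = (0, 0)" unfolding B_def P_def by fastforce
      then show False using A(2) primitive_part_nonzero[of N] by metis
    qed
    have Pr: "1 \<le> ?r p" "p \<noteq> (0, 0)" "real (sup_size p) \<le> L" if p: "p \<in> P" for p
    proof -
      show "p \<noteq> (0, 0)" using p P0 by metis
      show "real (sup_size p) \<le> L" using p by (auto simp: B_def P_def)
      with \<open>p \<noteq> (0, 0)\<close> show "1 \<le> ?r p" using sup_size_pos[of p] by simp
    qed
    have far: "(\<Sum>N\<in>A - B. ?j (x + pt L N) * (1 + ?r (primitive_part N))) \<le> 2 * C1 * L\<^sup>2"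
    proof -
      have "(\<Sum>N\<in>A - B. ?j (x + pt L N) * (1 + ?r (primitive_part N))) \<le> (\<Sum>N\<in>A - B. ?j (x + pt L N) * 2)"
        using L by (intro sum_mono mult_left_mono) (auto simp: B_def divide_le_eq)
      also have "\<dots> \<le> C1 * L\<^sup>2 * 2"
        unfolding sum_distrib_right[symmetric] using A L by (intro mult_right_mono C1) auto
      finally show ?thesis by simp
    qed
    have fibre: "(\<Sum>N\<in>{N\<in>B. primitive_part N = p}. ?j (x + pt L N) * (1 + ?r (primitive_part N)))
        \<le> 4 * C2 * L\<^sup>2 * (1 / real (sup_size p) ^ 2)" if p: "p \<in> P" for p
    proof -
      have "(\<Sum>N\<in>{N\<in>B. primitive_part N = p}. ?j (x + pt L N) * (1 + ?r (primitive_part N)))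
          = (\<Sum>N\<in>{N\<in>B. primitive_part N = p}. ?j (x + pt L N)) * (1 + ?r p)"
        by (simp add: sum_distrib_right)
      also have "\<dots> \<le> (C2 * (1 + ?r p)) * (1 + ?r p)"
      proof (intro mult_right_mono C2)
        show "{N\<in>B. primitive_part N = p} \<subseteq> range (\<lambda>k. int_scale k p)"
          using int_scale_primitive_part by (metis (mono_tags, lifting) mem_Collect_eq rangeI subsetI)
      qed (use L fin Pr[OF p] in auto)
      also have "\<dots> \<le> (C2 * (2 * ?r p)) * (2 * ?r p)"
        using C2 L Pr[OF p] by (intro mult_mono) auto
      also have "\<dots> = 4 * C2 * L\<^sup>2 * (1 / real (sup_size p) ^ 2)"
        by (simp add: power2_eq_square)
      finally show ?thesis .
    qed
    have "(\<Sum>N\<in>B. ?j (x + pt L N) * (1 + ?r (primitive_part N)))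
        = (\<Sum>p\<in>P. \<Sum>N\<in>{N\<in>B. primitive_part N = p}. ?j (x + pt L N) * (1 + ?r (primitive_part N)))"
      using fin by (intro sum.group[symmetric]) (auto simp: P_def)
    also have "\<dots> \<le> (\<Sum>p\<in>P. 4 * C2 * L\<^sup>2 * (1 / real (sup_size p) ^ 2))"
      by (intro sum_mono fibre)
    also have "\<dots> = 4 * C2 * L\<^sup>2 * (\<Sum>p\<in>P. 1 / real (sup_size p) ^ 2)"
      by (simp add: sum_distrib_left)
    also have "\<dots> \<le> 4 * C2 * L\<^sup>2 * (12 * (1 + ln L))"
      using C2 fin P0 Pr L by (intro mult_left_mono sum_inverse_square_size_le) auto
    finally have near: "(\<Sum>N\<in>B. ?j (x + pt L N) * (1 + ?r (primitive_part N))) \<le> 48 * C2 * (L\<^sup>2 * (1 + ln L))"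
      by (simp add: algebra_simps)
    have "L\<^sup>2 * 1 \<le> L\<^sup>2 * (1 + ln L)" using L by (intro mult_left_mono) auto
    then have "2 * C1 * L\<^sup>2 \<le> 2 * C1 * (L\<^sup>2 * (1 + ln L))" using C1 by simp
    moreover have "(\<Sum>N\<in>A. ?j (x + pt L N) * (1 + ?r (primitive_part N)))
        = (\<Sum>N\<in>A - B. ?j (x + pt L N) * (1 + ?r (primitive_part N)))
          + (\<Sum>N\<in>B. ?j (x + pt L N) * (1 + ?r (primitive_part N)))"
      using A by (intro sum.subset_diff) (auto simp: B_def)
    ultimately show ?thesis using far near by (simp add: distrib_right)
  qed
  moreover have "2 * C1 + 48 * C2 > 0" using C1 C2 by simp
  ultimately show ?thesis by blast
qed

text \<open>The pairs with \<open>N = 0\<close> leave \<open>M\<close> free and are covered by the plane sum; the requirement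
  \<open>L \<ge> 2\<close> keeps \<open>1 + ln L\<close> comparable to \<open>ln L\<close>.\<close>

lemma orthogonal_pair_sum_bound:
  assumes "\<sigma> > 2"
  shows "\<exists>C>0. \<forall>L x R. L \<ge> 2 \<longrightarrow> finite R \<longrightarrow> R \<subseteq> orthogonal_pairs \<longrightarrow>
           (\<Sum>(N, M)\<in>R. japanese (x + pt L N) powr -\<sigma> * japanese (x + pt L N + pt L M) powr -\<sigma>)
             \<le> C * (L\<^sup>2 * ln L)"
proof -
  let ?j = "\<lambda>x. japanese x powr -\<sigma>"
  obtain C1 where C1: "C1 > 0" "\<And>L x S. 1 \<le> L \<Longrightarrow> finite S \<Longrightarrow> (\<Sum>p\<in>S. ?j (x + pt L p)) \<le> C1 * L\<^sup>2"
    using plane_decay_sum_bound[OF assms] by metis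
  have "\<sigma> > 1" using assms by simp
  then obtain C2 where C2: "C2 > 0" "\<And>L x N A. L \<ge> 1 \<Longrightarrow> N \<noteq> (0, 0) \<Longrightarrow> finite A \<Longrightarrow>
      A \<subseteq> orthogonal_pairs `` {N} \<Longrightarrow>
      (\<Sum>M\<in>A. ?j (x + pt L M)) \<le> C2 * (1 + L / sup_size (primitive_part N))"
    using orthogonal_line_sum_bound[of \<sigma>] by blast
  obtain C3 where C3: "C3 > 0" "\<And>L x A. L \<ge> 1 \<Longrightarrow> finite A \<Longrightarrow> (0, 0) \<notin> A \<Longrightarrow>
      (\<Sum>N\<in>A. ?j (x + pt L N) * (1 + L / sup_size (primitive_part N))) \<le> C3 * (L\<^sup>2 * (1 + ln L))"
    using primitive_direction_sum_bound[OF assms] by blast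
  \<comment> \<open>\<open>1 + ln L \<le> (1 / ln 2 + 1) * ln L\<close> for \<open>L \<ge> 2\<close>\<close>
  define D where "D = (C1 + C2 * C3) * (1 / ln 2 + 1)"
  have "(\<Sum>(N, M)\<in>R. ?j (x + pt L N) * ?j (x + pt L N + pt L M)) \<le> D * (L\<^sup>2 * ln L)"
    if L: "L \<ge> 2" and R: "finite R" "R \<subseteq> orthogonal_pairs" for L x R
  proof -
    have fin: "finite (R `` {N})" for N using R(1) by (rule finite_Image)
    define G where "G N = (\<Sum>M\<in>R `` {N}. ?j (x + pt L N + pt L M))" for N
    have "R = Sigma (fst ` R) (\<lambda>N. R `` {N})" by (auto intro: rev_image_eqI)
    then have "(\<Sum>(N, M)\<in>R. ?j (x + pt L N) * ?j (x + pt L N + pt L M))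
        = (\<Sum>(N, M)\<in>Sigma (fst ` R) (\<lambda>N. R `` {N}). ?j (x + pt L N) * ?j (x + pt L N + pt L M))"
      by (rule arg_cong)
    also have "\<dots> = (\<Sum>N\<in>fst ` R. ?j (x + pt L N) * G N)"
      using R fin by (subst sum.Sigma[symmetric]) (auto simp: G_def sum_distrib_left)
    also have "\<dots> \<le> (\<Sum>N\<in>insert (0, 0) (fst ` R - {(0, 0)}). ?j (x + pt L N) * G N)"
      using R by (intro sum_mono2) (auto simp: G_def intro!: mult_nonneg_nonneg sum_nonneg)
    also have "\<dots> = ?j (x + pt L (0, 0)) * G (0, 0) + (\<Sum>N\<in>fst ` R - {(0, 0)}. ?j (x + pt L N) * G N)"
      using R by (subst sum.insert) auto
    also have "\<dots> \<le> 1 * (C1 * L\<^sup>2) + C2 * (C3 * (L\<^sup>2 * (1 + ln L)))"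
    proof (intro add_mono)
      show "?j (x + pt L (0, 0)) * G (0, 0) \<le> 1 * (C1 * L\<^sup>2)"
        using L fin assms unfolding G_def
        by (intro mult_mono C1 japanese_powr_le_1 sum_nonneg) auto
      have "(\<Sum>N\<in>fst ` R - {(0, 0)}. ?j (x + pt L N) * G N)
          \<le> (\<Sum>N\<in>fst ` R - {(0, 0)}. ?j (x + pt L N) * (C2 * (1 + L / sup_size (primitive_part N))))"
        unfolding G_def using L R fin by (intro sum_mono mult_left_mono C2) auto
      also have "\<dots> = C2 * (\<Sum>N\<in>fst ` R - {(0, 0)}. ?j (x + pt L N) * (1 + L / sup_size (primitive_part N)))"
        by (simp add: sum_distrib_left mult_ac)
      also have "\<dots> \<le> C2 * (C3 * (L\<^sup>2 * (1 + ln L)))"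
        using C2 L R by (intro mult_left_mono C3) auto
      finally show "(\<Sum>N\<in>fst ` R - {(0, 0)}. ?j (x + pt L N) * G N) \<le> C2 * (C3 * (L\<^sup>2 * (1 + ln L)))" .
    qed
    also have "\<dots> \<le> (C1 + C2 * C3) * (L\<^sup>2 * (1 + ln L))"
      using C1 L by (simp add: algebra_simps)
    also have "\<dots> \<le> (C1 + C2 * C3) * (L\<^sup>2 * ((1 / ln 2 + 1) * ln L))"
    proof -
      have "ln 2 \<le> ln L" using L by simp
      then have "1 + ln L \<le> (1 / ln 2 + 1) * ln L" by (simp add: field_simps)
      then show ?thesis using C1 C2 C3 by (intro mult_left_mono) auto
    qed
    finally show ?thesis by (simp add: D_def mult_ac)
  qed
  moreover have "D > 0" unfolding D_def using C1 C2 C3 by (intro mult_pos_pos add_pos_pos) auto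
  ultimately show ?thesis by blast
qed

section \<open>Resonant triples\<close>

definition rectangle :: "real \<Rightarrow> real^2 \<Rightarrow> (int \<times> int) \<times> (int \<times> int) \<Rightarrow> (real^2) \<times> (real^2) \<times> (real^2)" where
  "rectangle L K = (\<lambda>(N, M). (K + pt L N, K + pt L N + pt L M, K + pt L M))"

lemma pt_add: "pt L (p + q) = pt L p + pt L q"
  by (simp add: vec_eq_iff forall_2 add_divide_distrib)

lemma pt_diff: "pt L (p - q) = pt L p - pt L q"
  by (simp add: vec_eq_iff forall_2 diff_divide_distrib)

lemma orthogonal_pairs_iff:
  assumes "L > 0"
  shows "(N, M) \<in> orthogonal_pairs \<longleftrightarrow> pt L N \<bullet> pt L M = 0"
proof -
  have "pt L N \<bullet> pt L M = real_of_int (fst N * fst M + snd N * snd M) / (L * L)"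
    using assms by (simp add: inner_vec_def sum_2 add_divide_distrib)
  then show ?thesis
    using assms by (simp add: orthogonal_pairs_def del: of_int_add of_int_mult)
qed

text \<open>With \<open>u = K1 - K\<close> and \<open>v = K3 - K\<close> one has \<open>K2 = K + u + v\<close>, and the second resonance
  condition reduces to \<open>u \<bullet> v = 0\<close>.\<close>

lemma resonant_eq_rectangles:
  assumes L: "L > 0" and K: "K \<in> lattice2 L"
  shows "resonant L K = rectangle L K ` orthogonal_pairs"
proof -
  have expand: "(norm (K + u))\<^sup>2 - (norm (K + u + v))\<^sup>2 + (norm (K + v))\<^sup>2 - (norm K)\<^sup>2
      = - 2 * (u \<bullet> v)" for u v
    by (simp add: power2_norm_eq_inner inner_add_left inner_add_right inner_commute)
  obtain k where k: "K = pt L k" using K by (auto simp: lattice2_eq)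
  show ?thesis
  proof (intro equalityI subsetI)
    fix t assume "t \<in> resonant L K"
    then obtain K1 K2 K3 where t: "t = (K1, K2, K3)" "K1 \<in> lattice2 L" "K3 \<in> lattice2 L"
        "K1 - K2 + K3 = K" "(norm K1)\<^sup>2 - (norm K2)\<^sup>2 + (norm K3)\<^sup>2 - (norm K)\<^sup>2 = 0"
      by (auto simp: resonant_def)
    obtain n m where nm: "K1 = pt L n" "K3 = pt L m" using t by (auto simp: lattice2_eq)
    define N M where "N = n - k" and "M = m - k"
    have K1: "K1 = K + pt L N" and K3: "K3 = K + pt L M"
      by (simp_all add: N_def M_def nm k pt_diff)
    have K2: "K2 = K + pt L N + pt L M" using t(4) K1 K3 by (simp add: algebra_simps)
    have "(N, M) \<in> orthogonal_pairs"
      using t(5) expand[of "pt L N" "pt L M"] K1 K2 K3 orthogonal_pairs_iff[OF L] by simp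
    then show "t \<in> rectangle L K ` orthogonal_pairs"
      by (intro image_eqI[of _ _ "(N, M)"]) (simp_all add: rectangle_def t(1) K1 K2 K3)
  next
    fix t assume "t \<in> rectangle L K ` orthogonal_pairs"
    then obtain N M where NM: "(N, M) \<in> orthogonal_pairs" "t = rectangle L K (N, M)" by auto
    have "K + pt L N \<in> lattice2 L" "K + pt L M \<in> lattice2 L" "K + pt L N + pt L M \<in> lattice2 L"
      unfolding k pt_add[symmetric] lattice2_eq by auto
    then show "t \<in> resonant L K"
      using NM expand[of "pt L N" "pt L M"] orthogonal_pairs_iff[OF L]
      by (simp add: resonant_def rectangle_def)
  qed
qed

lemma inj_rectangle: "L \<noteq> 0 \<Longrightarrow> inj (rectangle L K)"
  by (auto simp: inj_def rectangle_def vec_eq_iff forall_2 prod_eq_iff)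

text \<open>In a rectangle, \<open>norm K\<^sup>2 \<le> norm K1\<^sup>2 + norm K3\<^sup>2\<close>, so the larger of \<open>K1\<close> and \<open>K3\<close> supplies
  the decay in \<open>K\<close>.\<close>

lemma resonant_decay:
  assumes "\<sigma> \<ge> 0" "(K1, K2, K3) \<in> resonant L K"
  shows "japanese K1 powr -\<sigma> * japanese K3 powr -\<sigma>
    \<le> sqrt 2 powr \<sigma> * japanese K powr -\<sigma> * (japanese K1 powr -\<sigma> + japanese K3 powr -\<sigma>)"
proof -
  let ?c = "sqrt 2 powr \<sigma> * japanese K powr -\<sigma>"
  have pos: "japanese x > 0" for x using japanese_ge_1[of x] by linarith
  have big: "japanese x powr -\<sigma> \<le> ?c" if "(japanese K)\<^sup>2 \<le> 2 * (japanese x)\<^sup>2" for x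
  proof -
    have "(japanese K / sqrt 2)\<^sup>2 \<le> (japanese x)\<^sup>2" using that by (simp add: power_divide)
    then have "japanese K / sqrt 2 \<le> japanese x"
      using pos[of x] by (auto intro: power2_le_imp_le[OF _ less_imp_le])
    then have "japanese x powr -\<sigma> \<le> (japanese K / sqrt 2) powr -\<sigma>"
      using assms(1) pos[of K] by (intro powr_mono2') auto
    also have "\<dots> = ?c" using pos[of K] by (simp add: powr_divide powr_minus field_simps)
    finally show ?thesis .
  qed
  have "(norm K1)\<^sup>2 - (norm K2)\<^sup>2 + (norm K3)\<^sup>2 - (norm K)\<^sup>2 = 0"
    using assms(2) by (simp add: resonant_def)
  then have "(norm K)\<^sup>2 \<le> (norm K1)\<^sup>2 + (norm K3)\<^sup>2"
    using zero_le_power2[of "norm K2"] by argo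
  then have "(japanese K)\<^sup>2 \<le> (japanese K1)\<^sup>2 + (japanese K3)\<^sup>2"
    by (simp add: japanese_def)
  then have "(japanese K)\<^sup>2 \<le> 2 * (japanese K1)\<^sup>2 \<or> (japanese K)\<^sup>2 \<le> 2 * (japanese K3)\<^sup>2"
    by linarith
  then show ?thesis
  proof
    assume "(japanese K)\<^sup>2 \<le> 2 * (japanese K1)\<^sup>2"
    then have "japanese K1 powr -\<sigma> * japanese K3 powr -\<sigma> \<le> ?c * japanese K3 powr -\<sigma>"
      by (intro mult_right_mono big) auto
    also have "\<dots> \<le> ?c * (japanese K1 powr -\<sigma> + japanese K3 powr -\<sigma>)"
      by (intro mult_left_mono) auto
    finally show ?thesis .
  next
    assume "(japanese K)\<^sup>2 \<le> 2 * (japanese K3)\<^sup>2"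
    then have "japanese K1 powr -\<sigma> * japanese K3 powr -\<sigma> \<le> japanese K1 powr -\<sigma> * ?c"
      by (intro mult_left_mono big) auto
    also have "\<dots> \<le> (japanese K1 powr -\<sigma> + japanese K3 powr -\<sigma>) * ?c"
      by (intro mult_right_mono) auto
    finally show ?thesis by (simp add: mult_ac)
  qed
qed

text \<open>After one factor has been spent on the decay in \<open>K\<close>, the two remaining sums differ only by the
  symmetry exchanging \<open>K1\<close> and \<open>K3\<close>.\<close>

lemma resonant_sum_bound:
  assumes "\<sigma> > 2"
  shows "\<exists>C>0. \<forall>L K F. L \<ge> 2 \<longrightarrow> K \<in> lattice2 L \<longrightarrow> finite F \<longrightarrow> F \<subseteq> resonant L K \<longrightarrow>
           (\<Sum>(K1, K2, K3)\<in>F. japanese K1 powr -\<sigma> * japanese K2 powr -\<sigma> * japanese K3 powr -\<sigma>)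
             \<le> C * (L\<^sup>2 * ln L) * japanese K powr -\<sigma>"
proof -
  let ?j = "\<lambda>x. japanese x powr -\<sigma>"
  obtain C where C: "C > 0" "\<And>L x R. L \<ge> 2 \<Longrightarrow> finite R \<Longrightarrow> R \<subseteq> orthogonal_pairs \<Longrightarrow>
      (\<Sum>(N, M)\<in>R. ?j (x + pt L N) * ?j (x + pt L N + pt L M)) \<le> C * (L\<^sup>2 * ln L)"
    using orthogonal_pair_sum_bound[OF assms] by blast
  have "(\<Sum>(K1, K2, K3)\<in>F. ?j K1 * ?j K2 * ?j K3) \<le> (2 * sqrt 2 powr \<sigma> * C) * (L\<^sup>2 * ln L) * ?j K"
    if L: "L \<ge> 2" and K: "K \<in> lattice2 L" and F: "finite F" "F \<subseteq> resonant L K" for L K F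
  proof -
    let ?c = "sqrt 2 powr \<sigma> * ?j K"
    have res: "resonant L K = rectangle L K ` orthogonal_pairs"
      using L K by (intro resonant_eq_rectangles) auto
    obtain R where R: "finite R" "R \<subseteq> orthogonal_pairs" "F = rectangle L K ` R"
      using finite_subset_image[of F "rectangle L K" orthogonal_pairs] F res by auto
    have le: "?j K1 * ?j K2 * ?j K3 \<le> ?c * (?j K1 * ?j K2 + ?j K3 * ?j K2)"
      if "(K1, K2, K3) \<in> resonant L K" for K1 K2 K3
    proof -
      have "(?j K1 * ?j K3) * ?j K2 \<le> (?c * (?j K1 + ?j K3)) * ?j K2"
        using assms by (intro mult_right_mono resonant_decay[OF _ that]) auto
      then show ?thesis by (simp add: algebra_simps)
    qed
    have inj: "inj_on (rectangle L K) R"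
      using L by (intro inj_on_subset[OF inj_rectangle]) auto
    have swap: "prod.swap ` R \<subseteq> orthogonal_pairs"
      using R(2) by (auto simp: orthogonal_pairs_def mult.commute)
    have "(\<Sum>(K1, K2, K3)\<in>F. ?j K1 * ?j K2 * ?j K3)
        \<le> (\<Sum>(K1, K2, K3)\<in>F. ?c * (?j K1 * ?j K2 + ?j K3 * ?j K2))"
      using F by (intro sum_mono) (auto intro!: le)
    also have "\<dots> \<le> (\<Sum>(N, M)\<in>R. ?c * (?j (K + pt L N) * ?j (K + pt L N + pt L M)
                                  + ?j (K + pt L M) * ?j (K + pt L N + pt L M)))"
      unfolding R(3) sum.reindex[OF inj] by (simp add: rectangle_def case_prod_unfold)
    also have "\<dots> = ?c * ((\<Sum>(N, M)\<in>R. ?j (K + pt L N) * ?j (K + pt L N + pt L M))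
                      + (\<Sum>(N, M)\<in>R. ?j (K + pt L M) * ?j (K + pt L N + pt L M)))"
      by (simp add: sum_distrib_left sum.distrib case_prod_unfold distrib_left)
    also have "(\<Sum>(N, M)\<in>R. ?j (K + pt L M) * ?j (K + pt L N + pt L M))
        = (\<Sum>(N, M)\<in>prod.swap ` R. ?j (K + pt L N) * ?j (K + pt L N + pt L M))"
      by (simp add: sum.reindex case_prod_unfold add_ac)
    also have "?c * ((\<Sum>(N, M)\<in>R. ?j (K + pt L N) * ?j (K + pt L N + pt L M))
        + (\<Sum>(N, M)\<in>prod.swap ` R. ?j (K + pt L N) * ?j (K + pt L N + pt L M)))
        \<le> ?c * (C * (L\<^sup>2 * ln L) + C * (L\<^sup>2 * ln L))"
      using L R swap by (intro mult_left_mono add_mono C) auto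
    finally show ?thesis by (simp add: mult_ac)
  qed
  moreover have "2 * sqrt 2 powr \<sigma> * C > 0" using C by simp
  ultimately show ?thesis by blast
qed

section \<open>The trilinear estimate\<close>

lemma zeta2_pos: "zeta2 > 0"
  by (simp add: zeta2_def)

lemma lattice2_nonempty: "lattice2 L \<noteq> {}"
  by (simp add: lattice2_eq)

lemma X_norm_bound:
  assumes "a \<in> X_space \<sigma> L" "K \<in> lattice2 L"
  shows "norm (a K) \<le> X_norm \<sigma> L a * japanese K powr -\<sigma>"
proof -
  have "japanese K powr \<sigma> * norm (a K) \<le> X_norm \<sigma> L a"
    using assms unfolding X_norm_def X_space_def by (intro cSUP_upper) auto
  moreover have "japanese K > 0" using japanese_ge_1[of K] by linarith
  ultimately show ?thesis by (simp add: powr_minus field_simps)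
qed

lemma X_norm_nonneg:
  assumes "a \<in> X_space \<sigma> L"
  shows "X_norm \<sigma> L a \<ge> 0"
proof -
  obtain K where K: "K \<in> lattice2 L" using lattice2_nonempty by blast
  have "0 \<le> japanese K powr \<sigma> * norm (a K)" by simp
  also have "\<dots> \<le> X_norm \<sigma> L a"
    using assms K unfolding X_norm_def X_space_def by (intro cSUP_upper) auto
  finally show ?thesis .
qed

text \<open>Since the norm is a real supremum, a pointwise bound has to give membership and norm bound
  together.\<close>

lemma X_space_normI:
  assumes "\<And>K. K \<in> lattice2 L \<Longrightarrow> norm (a K) \<le> B * japanese K powr -\<sigma>"
  shows "a \<in> X_space \<sigma> L" "X_norm \<sigma> L a \<le> B"
proof -
  have *: "japanese K powr \<sigma> * norm (a K) \<le> B" if "K \<in> lattice2 L" for K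
  proof -
    have "japanese K > 0" using japanese_ge_1[of K] by linarith
    then show ?thesis using assms[OF that] by (simp add: powr_minus field_simps)
  qed
  then show "a \<in> X_space \<sigma> L" by (auto simp: X_space_def intro!: bdd_aboveI2)
  show "X_norm \<sigma> L a \<le> B"
    unfolding X_norm_def using * lattice2_nonempty by (intro cSUP_least) auto
qed

text \<open>The bound on finite partial sums yields absolute summability and controls the infinite sum at
  the same time.\<close>

lemma trilinear_estimate:
  assumes "\<sigma> > 2"
  shows "\<exists>C>0. \<forall>L\<ge>2. \<forall>a\<in>X_space \<sigma> L. \<forall>b\<in>X_space \<sigma> L. \<forall>c\<in>X_space \<sigma> L.
            (\<forall>K\<in>lattice2 L. (\<lambda>(K1, K2, K3). norm (a K1 * b K2 * c K3)) summable_on resonant L K) \<and>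
            T_op L a b c \<in> X_space \<sigma> L \<and>
            X_norm \<sigma> L (T_op L a b c) \<le> C * X_norm \<sigma> L a * X_norm \<sigma> L b * X_norm \<sigma> L c"
proof -
  let ?j = "\<lambda>x. japanese x powr -\<sigma>"
  obtain C where C: "C > 0" "\<And>L K F. L \<ge> 2 \<Longrightarrow> K \<in> lattice2 L \<Longrightarrow> finite F \<Longrightarrow> F \<subseteq> resonant L K \<Longrightarrow>
      (\<Sum>(K1, K2, K3)\<in>F. ?j K1 * ?j K2 * ?j K3) \<le> C * (L\<^sup>2 * ln L) * ?j K"
    using resonant_sum_bound[OF assms] by blast
  have "(\<forall>K\<in>lattice2 L. (\<lambda>(K1, K2, K3). norm (a K1 * b K2 * c K3)) summable_on resonant L K) \<and>
      T_op L a b c \<in> X_space \<sigma> L \<and>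
      X_norm \<sigma> L (T_op L a b c) \<le> (zeta2 / 2 * C) * X_norm \<sigma> L a * X_norm \<sigma> L b * X_norm \<sigma> L c"
    if L: "L \<ge> 2" and abc: "a \<in> X_space \<sigma> L" "b \<in> X_space \<sigma> L" "c \<in> X_space \<sigma> L" for L a b c
  proof -
    define D where "D = X_norm \<sigma> L a * X_norm \<sigma> L b * X_norm \<sigma> L c"
    have D: "D \<ge> 0" unfolding D_def using abc by (intro mult_nonneg_nonneg X_norm_nonneg)
    let ?f = "\<lambda>(K1, K2, K3). a K1 * b K2 * c K3"
    have fin: "(\<Sum>t\<in>F. norm (?f t)) \<le> D * (C * (L\<^sup>2 * ln L) * ?j K)"
      if K: "K \<in> lattice2 L" and F: "finite F" "F \<subseteq> resonant L K" for K F
    proof -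
      have "(\<Sum>t\<in>F. norm (?f t)) \<le> (\<Sum>(K1, K2, K3)\<in>F. D * (?j K1 * ?j K2 * ?j K3))"
      proof (intro sum_mono)
        fix t assume "t \<in> F"
        then obtain K1 K2 K3 where t: "t = (K1, K2, K3)"
            "K1 \<in> lattice2 L" "K2 \<in> lattice2 L" "K3 \<in> lattice2 L"
          using F by (auto simp: resonant_def)
        have "norm (a K1) * norm (b K2) * norm (c K3)
            \<le> (X_norm \<sigma> L a * ?j K1) * (X_norm \<sigma> L b * ?j K2) * (X_norm \<sigma> L c * ?j K3)"
          using t abc by (intro mult_mono X_norm_bound mult_nonneg_nonneg X_norm_nonneg) auto
        then show "norm (?f t) \<le> (case t of (K1, K2, K3) \<Rightarrow> D * (?j K1 * ?j K2 * ?j K3))"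
          by (simp add: t(1) norm_mult D_def mult_ac)
      qed
      also have "\<dots> = D * (\<Sum>(K1, K2, K3)\<in>F. ?j K1 * ?j K2 * ?j K3)"
        by (simp add: sum_distrib_left case_prod_unfold)
      also have "\<dots> \<le> D * (C * (L\<^sup>2 * ln L) * ?j K)"
        using L K F D by (intro mult_left_mono C) auto
      finally show ?thesis .
    qed
    have summable: "(\<lambda>t. norm (?f t)) summable_on resonant L K" if "K \<in> lattice2 L" for K
      using fin[OF that]
      by (intro nonneg_bdd_above_summable_on) (auto intro!: bdd_aboveI2 simp: case_prod_unfold)
    have "norm (T_op L a b c K) \<le> (zeta2 / 2 * C * D) * ?j K" if K: "K \<in> lattice2 L" for K
    proof -
      have ln: "ln L > 0" using L by simp
      have "norm (infsum ?f (resonant L K)) \<le> (\<Sum>\<^sub>\<infinity>t\<in>resonant L K. norm (?f t))"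
        using summable[OF K] by (rule norm_infsum_bound)
      also have "\<dots> \<le> D * (C * (L\<^sup>2 * ln L) * ?j K)"
        using summable[OF K] fin[OF K] by (intro infsum_le_finite_sums) auto
      finally have le: "norm (infsum ?f (resonant L K)) \<le> D * (C * (L\<^sup>2 * ln L) * ?j K)" .
      have "norm (T_op L a b c K) = zeta2 / (2 * L\<^sup>2 * ln L) * norm (infsum ?f (resonant L K))"
        unfolding T_op_def norm_mult norm_of_real using zeta2_pos ln L by simp
      also have "\<dots> \<le> zeta2 / (2 * L\<^sup>2 * ln L) * (D * (C * (L\<^sup>2 * ln L) * ?j K))"
        using zeta2_pos ln L by (intro mult_left_mono le) auto
      also have "\<dots> = (zeta2 / 2 * C * D) * ?j K"
        using ln L by (simp add: field_simps)
      finally show ?thesis .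
    qed
    from X_space_normI[OF this] show ?thesis
      using summable by (simp add: D_def mult_ac case_prod_unfold)
  qed
  moreover have "zeta2 / 2 * C > 0" using C zeta2_pos by simp
  ultimately show ?thesis by blast
qed

section \<open>Sharpness\<close>

definition coprime_triangle :: "nat \<Rightarrow> (nat \<times> nat) set" where
  "coprime_triangle n = {(x, y). 1 \<le> x \<and> x \<le> y \<and> y \<le> n \<and> coprime x y}"

lemma finite_coprime_triangle: "finite (coprime_triangle n)"
  by (rule finite_subset[of _ "{1..n} \<times> {1..n}"]) (auto simp: coprime_triangle_def)

lemma sum_inverse_squares_le_zeta2: "(\<Sum>g=1..n. 1 / real g ^ 2) \<le> zeta2"
proof -
  have "(\<Sum>g=1..n. 1 / real g ^ 2) = (\<Sum>i<n. 1 / (real i + 1)\<^sup>2)"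
    by (rule sum.reindex_bij_witness[of _ Suc "\<lambda>g. g - 1"]) (auto simp: add.commute)
  also have "\<dots> \<le> (\<Sum>i. 1 / (real i + 1)\<^sup>2)"
    using inverse_squares_sums by (intro sum_le_suminf) (auto simp: sums_iff add.commute)
  also have "\<dots> = zeta2"
    using inverse_squares_sums by (simp add: sums_iff zeta2_def add.commute)
  finally show ?thesis .
qed

text \<open>Every point of the triangle is a multiple \<open>g\<close> of a coprime one, and the multiples \<open>g\<close>
  cost at most \<open>\<Sum> 1 / g\<^sup>2 \<le> \<zeta>(2)\<close>; the whole triangle carries the harmonic sum.\<close>

lemma coprime_triangle_sum_ge: "harm n \<le> zeta2 * (\<Sum>(x, y)\<in>coprime_triangle n. 1 / real y ^ 2)"
proof -
  define w :: "nat \<times> nat \<Rightarrow> real" where "w = (\<lambda>(x, y). 1 / real y ^ 2)"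
  define mult where "mult = (\<lambda>(g::nat, x::nat, y::nat). (g * x, g * y))"
  let ?S = "{1..n} \<times> coprime_triangle n"
  have fin: "finite ?S" using finite_coprime_triangle by auto
  have "harm n = (\<Sum>y=1..n. \<Sum>x=1..y. 1 / real y ^ 2)"
    unfolding harm_def by (intro sum.cong) (auto simp: power2_eq_square field_simps)
  also have "\<dots> = (\<Sum>(y, x)\<in>Sigma {1..n} (\<lambda>y. {1..y}). 1 / real y ^ 2)"
    by (rule sum.Sigma) auto
  also have "\<dots> = sum w {(x, y). 1 \<le> x \<and> x \<le> y \<and> y \<le> n}"
    by (rule sum.reindex_bij_witness[of _ prod.swap prod.swap]) (auto simp: w_def)
  also have "\<dots> \<le> sum w (mult ` ?S)"
  proof (rule sum_mono2)
    show "finite (mult ` ?S)" using fin by auto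
    show "{(x, y). 1 \<le> x \<and> x \<le> y \<and> y \<le> n} \<subseteq> mult ` ?S"
    proof clarify
      fix x y :: nat assume xy: "1 \<le> x" "x \<le> y" "y \<le> n"
      define g where "g = gcd x y"
      have g: "g \<ge> 1" using xy by (simp add: g_def Suc_le_eq)
      obtain x' y' where x': "x = g * x'" "y = g * y'" unfolding g_def
        by (meson dvdE gcd_dvd1 gcd_dvd2)
      have "x' = x div g" "y' = y div g" using g x' by simp_all
      then have "coprime x' y'" using xy unfolding g_def by (simp add: div_gcd_coprime)
      moreover have "x' \<noteq> 0" using xy x' by auto
      moreover have "x' \<le> y'" using xy x' g by simp
      moreover have "y' \<le> y" using x' g by simp
      moreover have "g \<le> n" using xy gcd_le2_nat[of y x] unfolding g_def by linarith
      ultimately have "(g, x', y') \<in> ?S" using g xy by (simp add: coprime_triangle_def Suc_le_eq)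
      then show "(x, y) \<in> mult ` ?S" by (intro image_eqI[of _ _ "(g, x', y')"]) (simp_all add: mult_def x')
    qed
  qed (auto simp: w_def)
  also have "\<dots> \<le> sum (w \<circ> mult) ?S"
    using fin by (intro sum_image_le) (auto simp: w_def case_prod_unfold)
  also have "\<dots> = (\<Sum>(g, p)\<in>?S. (1 / real g ^ 2) * w p)"
    by (intro sum.cong) (auto simp: w_def mult_def power_mult_distrib)
  also have "\<dots> = (\<Sum>g=1..n. 1 / real g ^ 2) * sum w (coprime_triangle n)"
    by (simp add: sum_product sum.cartesian_product)
  also have "\<dots> \<le> zeta2 * sum w (coprime_triangle n)"
    by (intro mult_right_mono sum_inverse_squares_le_zeta2 sum_nonneg) (auto simp: w_def)
  finally show ?thesis by (simp add: w_def)
qed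

text \<open>The bound \<open>L / 2\<close> keeps \<open>N + M\<close>, and so the whole rectangle at \<open>0\<close>, within the unit box.\<close>

definition box_pairs :: "real \<Rightarrow> ((int \<times> int) \<times> (int \<times> int)) set" where
  "box_pairs L = {(N, M) \<in> orthogonal_pairs. sup_size N \<le> L / 2 \<and> sup_size M \<le> L / 2}"

text \<open>Distinct data \<open>(p, k, m)\<close> with coprime \<open>p\<close> and \<open>k, m > 0\<close> give distinct pairs
  \<open>(k p, m (rot p))\<close>, because \<open>k\<close> is the gcd of the first entry. A direction \<open>p = (x, y)\<close> with
  \<open>x \<le> y \<le> L / 2\<close> admits \<open>\<lfloor>L / (2 y)\<rfloor> \<ge> L / (4 y)\<close> choices for each of \<open>k\<close> and \<open>m\<close>, so the count is
  at least \<open>L\<^sup>2 / 16\<close> times the coprime sum of \<open>1 / y\<^sup>2\<close>.\<close>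

lemma many_box_pairs:
  fixes L :: real
  assumes L: "L \<ge> 4"
  obtains R where "finite R" "R \<subseteq> box_pairs L" "real (card R) \<ge> L\<^sup>2 * ln L / (32 * zeta2)"
proof -
  define n where "n = nat \<lfloor>L / 2\<rfloor>"
  define h where "h y = nat \<lfloor>L / (2 * real y)\<rfloor>" for y :: nat
  define Q where "Q = Sigma (coprime_triangle n) (\<lambda>p. {1..h (snd p)} \<times> {1..h (snd p)})"
  define \<tau> where "\<tau> = (\<lambda>((x::nat, y::nat), (k::nat, m::nat)).
      (int_scale (int k) (int x, int y), int_scale (int m) (rot (int x, int y))))"
  have finQ: "finite Q" unfolding Q_def using finite_coprime_triangle by auto
  have inj: "inj_on \<tau> Q"
  proof (rule inj_onI)
    fix q q' assume q: "q \<in> Q" "q' \<in> Q" "\<tau> q = \<tau> q'"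
    obtain x y k m where 1: "q = ((x, y), (k, m))" by (metis surj_pair)
    obtain x' y' k' m' where 2: "q' = ((x', y'), (k', m'))" by (metis surj_pair)
    have cop: "coprime x y" "coprime x' y'" and pos: "x > 0" "k > 0" "k' > 0"
      using q(1,2) by (auto simp: 1 2 Q_def coprime_triangle_def)
    have "int k * int x = int k' * int x'" "int k * int y = int k' * int y'"
        "int m * int x = int m' * int x'"
      using q(3) by (auto simp: 1 2 \<tau>_def int_scale_def rot_def)
    then have eq: "k * x = k' * x'" "k * y = k' * y'" "m * x = m' * x'"
      by (simp_all only: of_nat_mult[symmetric] of_nat_eq_iff)
    have "gcd (k * x) (k * y) = k" "gcd (k' * x') (k' * y') = k'"
      using cop by (simp_all add: gcd_mult_distrib_nat[symmetric])
    then have "k = k'" using eq by simp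
    then show "q = q'" using eq pos by (auto simp: 1 2)
  qed
  have sub: "\<tau> ` Q \<subseteq> box_pairs L"
  proof (rule image_subsetI)
    fix q assume "q \<in> Q"
    moreover obtain x y k m where q: "q = ((x, y), (k, m))" by (metis surj_pair)
    ultimately have xy: "1 \<le> x" "x \<le> y" and km: "k \<le> h y" "m \<le> h y"
      by (auto simp: Q_def coprime_triangle_def)
    have le: "real (i * z) \<le> L / 2" if "i \<le> h y" "z \<le> y" for i z
    proof -
      have "real i \<le> L / (2 * real y)" using that(1) L by (simp add: h_def le_nat_iff le_floor_iff)
      then have "real i * real y \<le> L / 2" using xy by (simp add: field_simps)
      moreover have "real i * real z \<le> real i * real y" using that by (intro mult_left_mono) auto
      ultimately show ?thesis by simp
    qed
    have size: "sup_size (int_scale (int i) (int x, int y)) = i * y" for i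
    proof -
      have "int i * int x \<le> int i * int y" using xy by (intro mult_left_mono) auto
      then show ?thesis by (simp add: sup_size_def int_scale_def max_absorb2 nat_mult_distrib)
    qed
    have "int_scale i (rot p) = rot (int_scale i p)" for i p
      by (simp add: int_scale_def rot_def)
    then show "\<tau> q \<in> box_pairs L"
      using le[OF km(1), of y] le[OF km(2), of y]
      by (simp add: box_pairs_def \<tau>_def q size) (simp add: orthogonal_pairs_def int_scale_def rot_def)
  qed
  have half_floor: "z / 2 \<le> real (nat \<lfloor>z\<rfloor>)" if "z \<ge> 1" for z :: real
  proof -
    have "\<lfloor>z\<rfloor> \<ge> 1" using that by simp
    then have "real (nat \<lfloor>z\<rfloor>) = real_of_int \<lfloor>z\<rfloor>" "real_of_int \<lfloor>z\<rfloor> \<ge> 1" by simp_all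
    moreover have "z < real_of_int \<lfloor>z\<rfloor> + 1" by linarith
    ultimately show ?thesis by argo
  qed
  have "n + 1 \<ge> L / 2" unfolding n_def by linarith
  then have "ln (L / 2) \<le> ln (real n + 1)" using L by (intro ln_mono) auto
  also have "\<dots> \<le> harm n" by (rule ln_le_harm)
  also have "\<dots> \<le> zeta2 * (\<Sum>(x, y)\<in>coprime_triangle n. 1 / real y ^ 2)"
    by (rule coprime_triangle_sum_ge)
  finally have sum: "ln (L / 2) / zeta2 \<le> (\<Sum>(x, y)\<in>coprime_triangle n. 1 / real y ^ 2)"
    using zeta2_pos by (simp add: field_simps)
  have "ln 4 \<le> ln L" using L by simp
  moreover have "ln 4 = 2 * ln (2::real)" using ln_realpow[of 2 2] by simp
  ultimately have "ln L / 2 \<le> ln (L / 2)" using L by (simp add: ln_div)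
  then have "L\<^sup>2 / 16 * (ln L / 2 / zeta2) \<le> L\<^sup>2 / 16 * (ln (L / 2) / zeta2)"
    using zeta2_pos by (intro mult_left_mono divide_right_mono) auto
  also have "\<dots> \<le> L\<^sup>2 / 16 * (\<Sum>(x, y)\<in>coprime_triangle n. 1 / real y ^ 2)"
    by (intro mult_left_mono sum) auto
  also have "\<dots> = (\<Sum>p\<in>coprime_triangle n. (L / (4 * real (snd p))) ^ 2)"
    by (simp add: sum_distrib_left case_prod_unfold power_divide power_mult_distrib)
  also have "\<dots> \<le> (\<Sum>p\<in>coprime_triangle n. real (h (snd p)) ^ 2)"
  proof (intro sum_mono power_mono)
    fix p assume "p \<in> coprime_triangle n"
    then have p: "1 \<le> snd p" "snd p \<le> n" by (auto simp: coprime_triangle_def)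
    then have "real (snd p) \<le> L / 2" using L by (simp add: n_def le_nat_iff le_floor_iff)
    then have "L / (2 * real (snd p)) \<ge> 1" using p by (simp add: field_simps)
    then have "L / (2 * real (snd p)) / 2 \<le> real (h (snd p))" unfolding h_def by (rule half_floor)
    then show "L / (4 * real (snd p)) \<le> real (h (snd p))" by simp
  qed (use L in auto)
  also have "\<dots> = real (card Q)"
    unfolding Q_def by (subst card_SigmaI) (auto simp: finite_coprime_triangle power2_eq_square)
  also have "\<dots> = real (card (\<tau> ` Q))" using inj by (simp add: card_image)
  finally show ?thesis using that[of "\<tau> ` Q"] finQ sub by (simp add: field_simps)
qed

definition box_indicator :: lseq where
  "box_indicator K = (if \<bar>K $ 1\<bar> \<le> 1 \<and> \<bar>K $ 2\<bar> \<le> 1 then 1 else 0)"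

lemma box_indicator_norm:
  assumes "\<sigma> \<ge> 0"
  shows "box_indicator \<in> X_space \<sigma> L" "X_norm \<sigma> L box_indicator \<le> sqrt 3 powr \<sigma>"
proof -
  have *: "norm (box_indicator K) \<le> sqrt 3 powr \<sigma> * japanese K powr -\<sigma>" for K
  proof (cases "\<bar>K $ 1\<bar> \<le> 1 \<and> \<bar>K $ 2\<bar> \<le> 1")
    case True
    then have "(K $ 1)\<^sup>2 \<le> 1" "(K $ 2)\<^sup>2 \<le> 1" by (simp_all add: abs_square_le_1)
    then have "japanese K \<le> sqrt 3" by (simp add: japanese_def norm_sq_2)
    then have "japanese K powr \<sigma> \<le> sqrt 3 powr \<sigma>"
      using assms japanese_ge_1[of K] by (intro powr_mono2) auto
    moreover have "japanese K > 0" using japanese_ge_1[of K] by linarith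
    ultimately show ?thesis using True by (simp add: box_indicator_def powr_minus field_simps)
  qed (auto simp: box_indicator_def)
  from X_space_normI[OF this]
  show "box_indicator \<in> X_space \<sigma> L" "X_norm \<sigma> L box_indicator \<le> sqrt 3 powr \<sigma>" by auto
qed

lemma box_indicator_rectangle:
  assumes "L > 0" "(N, M) \<in> box_pairs L"
  shows "box_indicator (pt L N) = 1" "box_indicator (pt L N + pt L M) = 1" "box_indicator (pt L M) = 1"
proof -
  have half: "\<bar>pt L p $ 1\<bar> \<le> 1 / 2" "\<bar>pt L p $ 2\<bar> \<le> 1 / 2" if "sup_size p \<le> L / 2" for p
  proof -
    have "\<bar>real_of_int (fst p)\<bar> \<le> L / 2" "\<bar>real_of_int (snd p)\<bar> \<le> L / 2"
      using that by (auto simp: sup_size_def max_def split: if_splits)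
    then show "\<bar>pt L p $ 1\<bar> \<le> 1 / 2" "\<bar>pt L p $ 2\<bar> \<le> 1 / 2"
      using assms(1) by (simp_all add: field_simps)
  qed
  have "sup_size N \<le> L / 2" "sup_size M \<le> L / 2" using assms(2) by (auto simp: box_pairs_def)
  note b = half[OF this(1)] half[OF this(2)]
  have "\<bar>pt L N $ 1\<bar> \<le> 1" "\<bar>pt L N $ 2\<bar> \<le> 1" "\<bar>pt L M $ 1\<bar> \<le> 1" "\<bar>pt L M $ 2\<bar> \<le> 1"
    using b by argo+
  then show "box_indicator (pt L N) = 1" "box_indicator (pt L M) = 1"
    by (simp_all add: box_indicator_def)
  have "\<bar>(pt L N + pt L M) $ 1\<bar> \<le> 1" "\<bar>(pt L N + pt L M) $ 2\<bar> \<le> 1"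
    using b unfolding vector_add_component by linarith+
  then show "box_indicator (pt L N + pt L M) = 1"
    by (simp add: box_indicator_def)
qed

text \<open>At \<open>K = 0\<close> the sum counts the rectangles inside the box, at least
  \<open>L\<^sup>2 ln L / (32 \<zeta>(2))\<close> of them, and the normalization turns this into \<open>1 / 64\<close>.\<close>

lemma T_op_box_indicator_ge:
  assumes "\<sigma> > 2" "L \<ge> 4"
  shows "1 / 64 \<le> X_norm \<sigma> L (T_op L box_indicator box_indicator box_indicator)"
proof -
  let ?b = box_indicator
  define g where "g = (\<lambda>(K1, K2, K3). (if ?b K1 * ?b K2 * ?b K3 = 0 then 0 else 1 :: real))"
  have bool: "?b K = 0 \<or> ?b K = 1" for K by (simp add: box_indicator_def)
  have g: "?b K1 * ?b K2 * ?b K3 = complex_of_real (g (K1, K2, K3))" for K1 K2 K3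
    using bool[of K1] bool[of K2] bool[of K3] by (auto simp: g_def)
  have g0: "0 \<le> g t" for t by (auto simp: g_def split: prod.split)
  have 0: "0 \<in> lattice2 L"
    using assms pt_eq_0_iff[of L "(0, 0)"] by (auto simp: lattice2_eq image_iff intro!: exI[of _ 0])
  have b: "?b \<in> X_space \<sigma> L" using box_indicator_norm(1)[of \<sigma>] assms by simp
  have L2: "L \<ge> 2" using assms by simp
  have tri: "(\<lambda>(K1, K2, K3). norm (?b K1 * ?b K2 * ?b K3)) summable_on resonant L 0"
      "T_op L ?b ?b ?b \<in> X_space \<sigma> L"
    using trilinear_estimate[OF assms(1)] L2 b 0 by blast+
  have "(\<lambda>(K1, K2, K3). norm (?b K1 * ?b K2 * ?b K3)) = g"
    using g0 by (auto simp: fun_eq_iff g)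
  with tri have sg: "g summable_on resonant L 0" by simp
  obtain R where R: "finite R" "R \<subseteq> box_pairs L" "real (card R) \<ge> L\<^sup>2 * ln L / (32 * zeta2)"
    using many_box_pairs[OF assms(2)] .
  have inj: "inj_on (rectangle L 0) R"
    using assms by (intro inj_on_subset[OF inj_rectangle]) auto
  have "real (card R) = (\<Sum>t\<in>rectangle L 0 ` R. g t)"
  proof -
    have "g (rectangle L 0 r) = 1" if "r \<in> R" for r
    proof -
      obtain N M where r: "r = (N, M)" by (cases r)
      have "(N, M) \<in> box_pairs L" using that R r by auto
      from box_indicator_rectangle[OF _ this] show ?thesis
        using assms by (simp add: r g_def rectangle_def)
    qed
    then show ?thesis using inj by (simp add: sum.reindex)
  qed
  also have "\<dots> \<le> infsum g (resonant L 0)"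
  proof (rule finite_sum_le_infsum[OF sg])
    have "R \<subseteq> orthogonal_pairs" using R(2) by (auto simp: box_pairs_def)
    then show "rectangle L 0 ` R \<subseteq> resonant L 0"
      using resonant_eq_rectangles[OF _ 0] assms by auto
  qed (use R g0 in auto)
  finally have count: "L\<^sup>2 * ln L / (32 * zeta2) \<le> infsum g (resonant L 0)"
    using R(3) by linarith
  have ln: "ln L > 0" using assms by simp
  have "(\<Sum>\<^sub>\<infinity>(K1, K2, K3)\<in>resonant L 0. ?b K1 * ?b K2 * ?b K3)
      = (\<Sum>\<^sub>\<infinity>t\<in>resonant L 0. complex_of_real (g t))"
    by (intro infsum_cong) (auto simp: g)
  also have "\<dots> = complex_of_real (infsum g (resonant L 0))"
    using has_sum_of_real[OF has_sum_infsum[OF sg]] by (rule infsumI)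
  finally have "norm (T_op L ?b ?b ?b 0) = zeta2 / (2 * L\<^sup>2 * ln L) * \<bar>infsum g (resonant L 0)\<bar>"
    unfolding T_op_def norm_mult norm_of_real using zeta2_pos ln assms by simp
  also have "\<dots> \<ge> zeta2 / (2 * L\<^sup>2 * ln L) * (L\<^sup>2 * ln L / (32 * zeta2))"
    using count zeta2_pos ln assms by (intro mult_left_mono) auto
  moreover have "zeta2 / (2 * L\<^sup>2 * ln L) * (L\<^sup>2 * ln L / (32 * zeta2)) = 1 / 64"
    using zeta2_pos ln assms by (simp add: field_simps)
  ultimately have "1 / 64 \<le> norm (T_op L ?b ?b ?b 0)" by linarith
  also have "\<dots> \<le> X_norm \<sigma> L (T_op L ?b ?b ?b)"
    using X_norm_bound[OF tri(2) 0] by (simp add: japanese_def)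
  finally show ?thesis .
qed

section \<open>The sharp estimate\<close>

theorem theorem2p2:
  fixes \<sigma> :: real
  assumes "\<sigma> > 2"
  shows "(\<exists>C>0. \<forall>L\<ge>2. \<forall>a\<in>X_space \<sigma> L. \<forall>b\<in>X_space \<sigma> L. \<forall>c\<in>X_space \<sigma> L.
            (\<forall>K\<in>lattice2 L. (\<lambda>(K1, K2, K3). norm (a K1 * b K2 * c K3)) summable_on resonant L K) \<and>
            T_op L a b c \<in> X_space \<sigma> L \<and>
            X_norm \<sigma> L (T_op L a b c) \<le> C * X_norm \<sigma> L a * X_norm \<sigma> L b * X_norm \<sigma> L c) \<and>
         (\<exists>c0>0. \<forall>\<^sub>F L in at_top.
            \<exists>a\<in>X_space \<sigma> L. \<exists>b\<in>X_space \<sigma> L. \<exists>c\<in>X_space \<sigma> L.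
              (\<exists>K\<in>lattice2 L. a K \<noteq> 0) \<and> (\<exists>K\<in>lattice2 L. b K \<noteq> 0) \<and> (\<exists>K\<in>lattice2 L. c K \<noteq> 0) \<and>
              X_norm \<sigma> L (T_op L a b c) \<ge> c0 * X_norm \<sigma> L a * X_norm \<sigma> L b * X_norm \<sigma> L c)"
proof (intro conjI trilinear_estimate[OF assms])
  let ?b = box_indicator and ?B = "sqrt 3 powr \<sigma>"
  \<comment> \<open>\<open>?B\<close> bounds the norm of each of the three factors\<close>
  define c0 where "c0 = 1 / (64 * ?B ^ 3)"
  have c0: "c0 > 0" by (simp add: c0_def)
  have nonzero: "\<exists>K\<in>lattice2 L. ?b K \<noteq> 0" for L
    by (intro bexI[of _ "pt L (0, 0)"]) (auto simp: box_indicator_def lattice2_eq)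
  have "c0 * X_norm \<sigma> L ?b * X_norm \<sigma> L ?b * X_norm \<sigma> L ?b \<le> X_norm \<sigma> L (T_op L ?b ?b ?b)"
    if L: "L \<ge> 4" for L
  proof -
    have b: "?b \<in> X_space \<sigma> L" "X_norm \<sigma> L ?b \<le> ?B"
      using box_indicator_norm[of \<sigma> L] assms by auto
    have "c0 * X_norm \<sigma> L ?b ^ 3 \<le> c0 * ?B ^ 3"
      using c0 b X_norm_nonneg[OF b(1)] by (intro mult_left_mono power_mono) auto
    also have "\<dots> = 1 / 64" by (simp add: c0_def)
    also have "\<dots> \<le> X_norm \<sigma> L (T_op L ?b ?b ?b)"
      by (rule T_op_box_indicator_ge[OF assms L])
    finally show ?thesis by (simp add: power3_eq_cube mult.assoc)
  qed
  then have "\<forall>L\<ge>4. \<exists>a\<in>X_space \<sigma> L. \<exists>b\<in>X_space \<sigma> L. \<exists>c\<in>X_space \<sigma> L.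
      (\<exists>K\<in>lattice2 L. a K \<noteq> 0) \<and> (\<exists>K\<in>lattice2 L. b K \<noteq> 0) \<and> (\<exists>K\<in>lattice2 L. c K \<noteq> 0) \<and>
      X_norm \<sigma> L (T_op L a b c) \<ge> c0 * X_norm \<sigma> L a * X_norm \<sigma> L b * X_norm \<sigma> L c"
    using box_indicator_norm(1)[of \<sigma>] assms nonzero by (meson less_eq_real_def order.trans zero_le_numeral)
  then have "\<forall>\<^sub>F L in at_top. \<exists>a\<in>X_space \<sigma> L. \<exists>b\<in>X_space \<sigma> L. \<exists>c\<in>X_space \<sigma> L.
      (\<exists>K\<in>lattice2 L. a K \<noteq> 0) \<and> (\<exists>K\<in>lattice2 L. b K \<noteq> 0) \<and> (\<exists>K\<in>lattice2 L. c K \<noteq> 0) \<and>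
      X_norm \<sigma> L (T_op L a b c) \<ge> c0 * X_norm \<sigma> L a * X_norm \<sigma> L b * X_norm \<sigma> L c"
    unfolding eventually_at_top_linorder by blast
  then show "\<exists>c0>0. \<forall>\<^sub>F L in at_top. \<exists>a\<in>X_space \<sigma> L. \<exists>b\<in>X_space \<sigma> L. \<exists>c\<in>X_space \<sigma> L.
      (\<exists>K\<in>lattice2 L. a K \<noteq> 0) \<and> (\<exists>K\<in>lattice2 L. b K \<noteq> 0) \<and> (\<exists>K\<in>lattice2 L. c K \<noteq> 0) \<and>
      X_norm \<sigma> L (T_op L a b c) \<ge> c0 * X_norm \<sigma> L a * X_norm \<sigma> L b * X_norm \<sigma> L c"
    using c0 by blast
qed

end
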